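(* Every $2$-degenerate graph $G$ is equitable list point $k$-arborable for every integer $k\geq \lceil (\Delta(G)+1)/2\rceil$, where $\Delta(G)$ is the maximum degree of $G$.
   Context: All graphs are finite, simple and undirected. A graph is $d$-degenerate if every subgraph of it has a vertex of degree at most $d$. A $k$-list assignment of a graph $G$ assigns to each vertex $v$ a set (list) $L(v)$ of $k$ colors. A graph $G$ is equitable list point $k$-arborable if for every $k$-list assignment $L$ one can choose $c(v)\in L(v)$ for each vertex $v$ such that each color class induces an acyclic subgraph (a forest) of $G$ and each color appears on at most $\lceil |V(G)|/k\rceil$ vertices of $G$. *)

theory Defs
  imports Complex_Main "Graph_Theory.Graph_Theory"
begin

text \<open>
  A finite simple undirected graph is a loop-free symmetric digraph without multiple arcs
  (locale \<^locale>\<open>graph\<close>): every edge is represented by its two opposite arcs. Hence the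
  degree of a vertex is its out-degree, and the undirected subgraphs of \<open>G\<close> are those
  \<open>H\<close> with \<^term>\<open>subgraph H G\<close> that are themselves symmetric.
\<close>

abbreviation degree :: "('a, 'b) pre_digraph \<Rightarrow> 'a \<Rightarrow> nat" where
  "degree G v \<equiv> out_degree G v"

(* The inserted 0 gives the null graph maximum degree 0 and is harmless otherwise. *)
definition max_degree :: "('a, 'b) pre_digraph \<Rightarrow> nat" where
  "max_degree G = Max (insert 0 (degree G ` verts G))"

definition degenerate :: "nat \<Rightarrow> ('a, 'b) pre_digraph \<Rightarrow> bool" where
  "degenerate d G \<longleftrightarrow>
    (\<forall>H. subgraph H G \<and> graph H \<and> verts H \<noteq> {} \<longrightarrow> (\<exists>v \<in> verts H. degree H v \<le> d))"

(* In a symmetric digraph the back-and-forth walk u, v, u along an edge satisfies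
   pre_digraph.cycle, so the library's forest predicate only holds for edgeless graphs.
   The undirected cycles of a simple graph are the directed ones of length at least 3. *)
definition acyclic_graph :: "('a, 'b) pre_digraph \<Rightarrow> bool" where
  "acyclic_graph G \<longleftrightarrow> \<not> (\<exists>p. pre_digraph.cycle G p \<and> 3 \<le> length p)"

definition list_assignment :: "('a, 'b) pre_digraph \<Rightarrow> nat \<Rightarrow> ('a \<Rightarrow> 'c set) \<Rightarrow> bool" where
  "list_assignment G k L \<longleftrightarrow> (\<forall>v \<in> verts G. finite (L v) \<and> card (L v) = k)"

definition color_class :: "('a, 'b) pre_digraph \<Rightarrow> ('a \<Rightarrow> 'c) \<Rightarrow> 'c \<Rightarrow> 'a set" where
  "color_class G c x = {v \<in> verts G. c v = x}"

(* The first argument only fixes the type the colors are drawn from. *)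
definition equitable_list_point_arborable ::
    "'c itself \<Rightarrow> nat \<Rightarrow> ('a, 'b) pre_digraph \<Rightarrow> bool" where
  "equitable_list_point_arborable (_ :: 'c itself) k G \<longleftrightarrow>
    (\<forall>L :: 'a \<Rightarrow> 'c set. list_assignment G k L \<longrightarrow>
      (\<exists>c :: 'a \<Rightarrow> 'c.
        (\<forall>v \<in> verts G. c v \<in> L v) \<and>
        (\<forall>x. acyclic_graph (G \<restriction> color_class G c x)) \<and>
        (\<forall>x. int (card (color_class G c x)) \<le> \<lceil>real (card (verts G)) / real k\<rceil>)))"

end

theory Submission
  imports Defs
begin

text \<open>
  Induct on the number of vertices, removing \<open>k\<close> vertices at a time. The removed block consists of
  a vertex \<open>x\<close> of degree at most 2, a neighbor \<open>y\<close> of \<open>x\<close>, and \<open>k - 2\<close> further vertices obtained by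
  repeatedly taking a vertex of degree at most 2 from what is left. Given a coloring of the rest,
  color \<open>y\<close> first, then the \<open>k - 2\<close> vertices, then \<open>x\<close>, with pairwise distinct colors, each
  vertex avoiding every color that occurs twice among its neighbors outside the block. There are
  at most \<open>k - 1\<close>, 1 and 0 such repeated colors, respectively, so a color always remains. Every new
  vertex then has at most one neighbor of its own color, which creates no monochromatic cycle, and
  every color class grows by at most one.
\<close>

section \<open>Neighborhoods and vertices of small degree in induced subgraphs\<close>

definition neighbors :: "('a, 'b) pre_digraph \<Rightarrow> 'a \<Rightarrow> 'a set" where
  "neighbors G v = {u. v \<rightarrow>\<^bsub>G\<^esub> u}"

text \<open>The heads of the arcs of a closed walk are exactly its vertices.\<close>

definition forest_on :: "('a, 'b) pre_digraph \<Rightarrow> 'a set \<Rightarrow> bool" where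
  "forest_on G X \<longleftrightarrow> \<not> (\<exists>u p. pre_digraph.awalk G u p u \<and> distinct (map (head G) p) \<and>
    3 \<le> length p \<and> head G ` set p \<subseteq> X)"

lemma (in wf_digraph) neighbors_subset_verts: "neighbors G v \<subseteq> verts G"
  by (auto simp: neighbors_def)

lemma neighbors_eq_head_out_arcs: "neighbors G v = head G ` out_arcs G v"
  by (auto simp: neighbors_def arcs_ends_conv out_arcs_def image_iff)

lemma neighbors_induce_subgraph:
  assumes "v \<in> W"
  shows "neighbors (G \<restriction> W) v = neighbors G v \<inter> W"
  using assms by (auto simp: neighbors_def arcs_ends_conv image_iff)

lemma card_neighbors_le_degree:
  assumes "fin_digraph G"
  shows "card (neighbors G v) \<le> degree G v"
  using assms unfolding neighbors_eq_head_out_arcs out_degree_def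
  by (intro card_image_le fin_digraph.finite_out_arcs)

lemma (in graph) graph_induce_subgraph:
  assumes "W \<subseteq> verts G"
  shows "graph (G \<restriction> W)"
proof -
  have "symmetric (G \<restriction> W)"
    using sym_arcs unfolding symmetric_conv by fastforce
  moreover have "finite W"
    using assms finite_verts finite_subset by blast
  ultimately show ?thesis
    using no_loops no_multi_arcs
    by unfold_locales (auto simp: arc_to_ends_def)
qed

text \<open>Degeneracy is applied to the subgraph induced by \<open>W\<close>, whose neighborhoods
  are those of \<open>G\<close> cut down to \<open>W\<close>.\<close>

lemma (in graph) degenerate_small_degree_vertex:
  assumes "degenerate d G" "W \<subseteq> verts G" "W \<noteq> {}"
  obtains v where "v \<in> W" "card (neighbors G v \<inter> W) \<le> d"
proof -
  have gr: "graph (G \<restriction> W)"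
    using assms(2) by (rule graph_induce_subgraph)
  moreover have "subgraph (G \<restriction> W) G"
    using assms(2) by (rule subgraph_induce_subgraphI)
  ultimately obtain v where v: "v \<in> W" "degree (G \<restriction> W) v \<le> d"
    using assms(1,3) unfolding degenerate_def by force
  have "fin_digraph (G \<restriction> W)"
    using gr unfolding graph_def digraph_def by blast
  from card_neighbors_le_degree[OF this, of v] v show ?thesis
    by (intro that[of v]) (auto simp: neighbors_induce_subgraph)
qed

section \<open>Cycles as closed walks, and adding a vertex to a forest\<close>

text \<open>A cycle of the induced subgraph is also a closed walk of \<open>G\<close>, and all heads
  of its arcs lie in \<open>X\<close>.\<close>

lemma (in wf_digraph) forest_on_imp_acyclic_graph:
  assumes "forest_on G X" "X \<subseteq> verts G"
  shows "acyclic_graph (G \<restriction> X)"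
  unfolding acyclic_graph_def
proof safe
  fix p assume "pre_digraph.cycle (G \<restriction> X) p" and len: "3 \<le> length p"
  then obtain u where u: "pre_digraph.awalk (G \<restriction> X) u p u"
    and dist: "distinct (tl (pre_digraph.awalk_verts (G \<restriction> X) u p))" and ne: "p \<noteq> []"
    unfolding pre_digraph.cycle_def by blast
  have cas: "pre_digraph.cas (G \<restriction> X) u p u" and arcs: "set p \<subseteq> arcs (G \<restriction> X)"
    using u unfolding pre_digraph.awalk_def by auto
  \<comment> \<open>The vertices of a walk after its start are the heads of its arcs.\<close>
  have "distinct (map (head G) p)"
    using dist ne by (simp add: pre_digraph.awalk_verts_conv'[OF cas])
  moreover have "awalk u p u"
    using u induced_imp_subgraph[OF induced_induce[OF assms(2)]] by (rule subgraph_awalk_imp_awalk)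
  ultimately show False
    using assms(1) len arcs unfolding forest_on_def by force
qed

text \<open>Cut the walk just after the arc that enters \<open>v\<close> and exchange the two
  pieces.\<close>

lemma (in wf_digraph) closed_walk_rotate_to:
  assumes "awalk u p u" "distinct (map (head G) p)" "v \<in> head G ` set p"
  obtains q where "awalk v q v" "distinct (map (head G) q)" "set q = set p" "length q = length p"
proof -
  obtain r e s where p: "p = r @ e # s" and v: "v = head G e"
    using assms(3) by (auto dest: split_list)
  then have r: "awalk u (r @ [e]) v" and s: "awalk v s u"
    using assms(1) by (auto simp: awalk_simps)
  show ?thesis
    using awalk_appendI[OF s r] assms(2) p by (intro that[of "s @ r @ [e]"]) auto
qed

text \<open>A new cycle would have to pass through \<open>v\<close>, and its two neighbors on that
  cycle would be distinct and both in \<open>X\<close>.\<close>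

lemma (in graph) forest_on_insert:
  assumes "forest_on G X" "card (neighbors G v \<inter> X) \<le> 1"
  shows "forest_on G (insert v X)"
  unfolding forest_on_def
proof safe
  fix u p
  assume p: "awalk u p u" "distinct (map (head G) p)" "3 \<le> length p"
    and sub: "head G ` set p \<subseteq> insert v X"
  have "v \<in> head G ` set p"
    using assms(1) p sub unfolding forest_on_def by blast
  with p obtain q where q: "awalk v q v" "distinct (map (head G) q)" "set q = set p"
    "length q = length p"
    by (auto elim: closed_walk_rotate_to)
  \<comment> \<open>The rotated walk is split as \<open>f # r @ [g, e]\<close>: \<open>f\<close>
    leaves \<open>v\<close>, \<open>e\<close> returns to it, and \<open>g\<close> ends at the
    predecessor of \<open>v\<close>. Length at least 3 keeps the three arcs at different positions,
    so their heads differ.\<close>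
  obtain f q' where f: "q = f # q'" "2 \<le> length q'"
    using p(3) q(4) by (cases q) auto
  then obtain q'' e where e: "q' = q'' @ [e]" "q'' \<noteq> []"
    by (cases q' rule: rev_cases) fastforce+
  then obtain r g where g: "q'' = r @ [g]"
    by (cases q'' rule: rev_cases) auto
  have walk: "f \<in> arcs G" "tail G f = v" "e \<in> arcs G" "head G e = v" "tail G e = head G g"
    using q(1) f(1) e(1) g by (auto simp: awalk_simps)
  have ne: "head G f \<noteq> head G g" "head G f \<noteq> v" "head G g \<noteq> v"
    using q(2) f(1) e(1) g walk(4) by auto
  have "v \<rightarrow> head G f" "head G g \<rightarrow> v"
    using walk in_arcs_imp_in_arcs_ends by metis+
  then have "{head G f, head G g} \<subseteq> neighbors G v"
    using graph_symmetric by (auto simp: neighbors_def)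
  moreover have "{head G f, head G g} \<subseteq> X"
    using sub q(3) f(1) e(1) g ne by auto
  moreover have "finite (neighbors G v \<inter> X)"
    using neighbors_subset_verts finite_verts finite_subset by blast
  ultimately have "card {head G f, head G g} \<le> card (neighbors G v \<inter> X)"
    by (intro card_mono) auto
  then show False
    using assms(2) ne by simp
qed

section \<open>Greedy list coloring with pairwise distinct colors\<close>

text \<open>The fibers over repeated values are disjoint subsets of \<open>A\<close>, each with at
  least two elements.\<close>

lemma card_repeated_values:
  assumes "finite A"
  shows "finite {x. 2 \<le> card {u \<in> A. f u = x}}" (is "finite ?D")
    and "card {x. 2 \<le> card {u \<in> A. f u = x}} \<le> card A div 2"
proof -
  have "?D \<subseteq> f ` A"
  proof
    fix x assume "x \<in> ?D"
    then have "{u \<in> A. f u = x} \<noteq> {}"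
      by (intro notI) simp
    then show "x \<in> f ` A" by auto
  qed
  then show fin: "finite ?D"
    using assms finite_surj by blast
  have "card ?D * 2 \<le> (\<Sum>x\<in>?D. card {u \<in> A. f u = x})"
    using sum_mono[of ?D "\<lambda>_. 2" "\<lambda>x. card {u \<in> A. f u = x}"] by simp
  also have "\<dots> = card (\<Union>x\<in>?D. {u \<in> A. f u = x})"
    using fin assms by (subst card_UN_disjoint) auto
  also have "\<dots> \<le> card A"
    using assms by (intro card_mono) auto
  finally show "card ?D \<le> card A div 2"
    by linarith
qed

text \<open>The vertices of \<open>vs\<close> are colored from left to right; \<open>N v\<close> plays the role of the set of
  already colored neighbors of \<open>v\<close> outside \<open>vs\<close>.\<close>

lemma extend_list_coloring:
  fixes c0 :: "'a \<Rightarrow> 'c" and L :: "'a \<Rightarrow> 'c set" and N :: "'a \<Rightarrow> 'a set"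
  assumes "distinct vs" "\<And>v. v \<in> set vs \<Longrightarrow> finite (L v) \<and> finite (N v)"
    and "\<And>j. j < length vs \<Longrightarrow> j + card (N (vs ! j)) div 2 < card (L (vs ! j))"
  obtains c where "\<And>v. v \<notin> set vs \<Longrightarrow> c v = c0 v" "inj_on c (set vs)"
    "\<And>v. v \<in> set vs \<Longrightarrow> c v \<in> L v \<and> card {u \<in> N v. c0 u = c v} \<le> 1"
  using assms
proof (induction vs arbitrary: thesis rule: rev_induct)
  case Nil
  then show ?case by auto
next
  case (snoc v vs)
  have "\<And>j. j < length vs \<Longrightarrow> j + card (N (vs ! j)) div 2 < card (L (vs ! j))"
    using snoc.prems(4) by (metis length_append_singleton less_SucI nth_append)
  then obtain c where c: "\<And>v. v \<notin> set vs \<Longrightarrow> c v = c0 v" "inj_on c (set vs)"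
    "\<And>v. v \<in> set vs \<Longrightarrow> c v \<in> L v \<and> card {u \<in> N v. c0 u = c v} \<le> 1"
    using snoc.IH snoc.prems(2,3) by auto
  \<comment> \<open>The colors forbidden at \<open>v\<close> because two members of
    \<open>N v\<close> already have them. Together with the colors used on \<open>vs\<close> they
    are too few to exhaust \<open>L v\<close>.\<close>
  define D where "D = {x. 2 \<le> card {u \<in> N v. c0 u = x}}"
  have D: "finite D" "card D \<le> card (N v) div 2"
    using snoc.prems(3)[of v] card_repeated_values[of "N v" c0] by (auto simp: D_def)
  have "card (c ` set vs \<union> D) \<le> length vs + card (N v) div 2"
    using D(2) card_Un_le[of "c ` set vs" D] card_image_le[of "set vs" c] card_length[of vs]
    by simp
  also have "\<dots> < card (L v)"
    using snoc.prems(4)[of "length vs"] by simp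
  finally have "\<not> L v \<subseteq> c ` set vs \<union> D"
    using D(1) card_mono[of "c ` set vs \<union> D" "L v"] by auto
  then obtain x where x: "x \<in> L v" "x \<notin> c ` set vs" "x \<notin> D"
    by blast
  show ?case
  proof (rule snoc.prems(1))
    show "(c(v := x)) w = c0 w" if "w \<notin> set (vs @ [v])" for w
      using that c(1) by auto
    show "inj_on (c(v := x)) (set (vs @ [v]))"
      using c(2) x(2) snoc.prems(2) by (auto simp: inj_on_def)
    show "(c(v := x)) w \<in> L w \<and> card {u \<in> N w. c0 u = (c(v := x)) w} \<le> 1"
      if "w \<in> set (vs @ [v])" for w
      using that c(3) x(1,3) snoc.prems(2) by (auto simp: D_def)
  qed
qed

section \<open>Choosing the block of vertices to remove\<close>

text \<open>Take a vertex of small degree from what is left, \<open>m\<close> times. Its bound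
  survives later removals, since these only shrink the remaining set.\<close>

lemma (in graph) degenerate_peel:
  assumes "degenerate d G" "W \<subseteq> verts G" "m \<le> card W"
  obtains M where "M \<subseteq> W" "card M = m" "\<And>v. v \<in> M \<Longrightarrow> card (neighbors G v \<inter> (W - M)) \<le> d"
  using assms(3)
proof (induction m arbitrary: thesis)
  case 0
  then show ?case by force
next
  case (Suc m)
  have finW: "finite W"
    using assms(2) finite_verts finite_subset by blast
  obtain M where M: "M \<subseteq> W" "card M = m" "\<And>v. v \<in> M \<Longrightarrow> card (neighbors G v \<inter> (W - M)) \<le> d"
    using Suc by auto
  have finM: "finite M"
    using M(1) finW finite_subset by blast
  have "W - M \<noteq> {}" "W - M \<subseteq> verts G"
    using M(1,2) Suc.prems(2) assms(2) by auto
  then obtain v where v: "v \<in> W - M" "card (neighbors G v \<inter> (W - M)) \<le> d"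
    using degenerate_small_degree_vertex[OF assms(1)] by metis
  show ?case
  proof (rule Suc.prems(1))
    show "insert v M \<subseteq> W" "card (insert v M) = Suc m"
      using v(1) M(1,2) finM by auto
    fix w assume "w \<in> insert v M"
    then have "card (neighbors G w \<inter> (W - M)) \<le> d"
      using v(2) M(3) by blast
    moreover have "card (neighbors G w \<inter> (W - insert v M)) \<le> card (neighbors G w \<inter> (W - M))"
      using finW by (intro card_mono) auto
    ultimately show "card (neighbors G w \<inter> (W - insert v M)) \<le> d"
      by linarith
  qed
qed

text \<open>The last inequality is the one that greedy coloring requires of lists of size
  \<open>k\<close>: \<open>j\<close> colors are taken by earlier block vertices, and half the number
  of neighbors in the rest bounds the repeated colors.\<close>

lemma (in graph) degenerate_removable_block:
  assumes "degenerate 2 G" "W \<subseteq> verts G" "0 < k" "k \<le> card W"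
    and deg: "\<And>v. v \<in> verts G \<Longrightarrow> card (neighbors G v) < 2 * k"
  obtains vs where "distinct vs" "set vs \<subseteq> W" "length vs = k"
    "\<And>j. j < k \<Longrightarrow> j + card (neighbors G (vs ! j) \<inter> (W - set vs)) div 2 < k"
proof -
  have finW: "finite W"
    using assms(2) finite_verts finite_subset by blast
  have finN: "finite (neighbors G v)" for v
    using neighbors_subset_verts finite_verts finite_subset by blast
  have degI: "card (neighbors G v \<inter> B) div 2 < k" if "v \<in> W" for v B
  proof -
    have "card (neighbors G v \<inter> B) \<le> card (neighbors G v)"
      using finN by (intro card_mono) auto
    also have "\<dots> < 2 * k"
      using that assms(2) deg by blast
    finally show ?thesis by linarith
  qed
  have "W \<noteq> {}"
    using assms(3,4) by auto
  then obtain x where x: "x \<in> W" "card (neighbors G x \<inter> W) \<le> 2"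
    using degenerate_small_degree_vertex[OF assms(1,2)] by metis
  show ?thesis
  proof (cases "k = 1")
    \<comment> \<open>There is no room for a second vertex, but the degree bound
      \<open>2 * k\<close> alone leaves \<open>x\<close> at most one neighbor.\<close>
    case True
    then show ?thesis
      using x(1) degI by (intro that[of "[x]"]) auto
  next
    case False
    with assms(3) have k: "2 \<le> k" by linarith
    \<comment> \<open>Putting a neighbor of \<open>x\<close> into the block lowers the number of
      neighbors of \<open>x\<close> outside from 2 to 1. If \<open>x\<close> has no neighbor in
      \<open>W\<close>, any other vertex serves.\<close>
    obtain y where y: "y \<in> W" "y \<noteq> x" "card (neighbors G x \<inter> (W - {y})) \<le> 1"
    proof (cases "neighbors G x \<inter> W = {}")
      case True
      have "card (W - {x}) \<noteq> 0"
        using x(1) finW assms(4) k by (simp add: card_Diff_singleton)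
      then obtain y where "y \<in> W - {x}"
        by (metis card.empty ex_in_conv)
      moreover have "neighbors G x \<inter> (W - {y}) = {}"
        using True by blast
      ultimately show ?thesis
        by (intro that[of y]) auto
    next
      case False
      then obtain y where y: "y \<in> neighbors G x \<inter> W" by blast
      moreover have "y \<noteq> x"
        using y by (auto simp: neighbors_def dest: adj_not_same)
      moreover have "neighbors G x \<inter> (W - {y}) = (neighbors G x \<inter> W) - {y}"
        by blast
      ultimately show ?thesis
        using x(2) finW by (intro that[of y]) (auto simp: card_Diff_singleton)
    qed
    define W' where "W' = W - {x, y}"
    have "k - 2 \<le> card W'"
      using x(1) y(1,2) finW assms(4) by (simp add: W'_def card_Diff_subset)
    moreover have "W' \<subseteq> verts G"
      using assms(2) by (auto simp: W'_def)
    ultimately obtain M where M: "M \<subseteq> W'" "card M = k - 2"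
      "\<And>v. v \<in> M \<Longrightarrow> card (neighbors G v \<inter> (W' - M)) \<le> 2"
      using degenerate_peel[OF assms(1)] by metis
    have "finite M"
      using M(1) finW by (auto simp: W'_def intro: finite_subset)
    then obtain ms where ms: "set ms = M" "distinct ms"
      using finite_distinct_list by blast
    have len: "length ms = k - 2"
      using ms M(2) distinct_card by fastforce
    \<comment> \<open>The order balances the two summands: \<open>y\<close> may face
      \<open>k - 1\<close> repeated colors but comes first, the vertices of \<open>ms\<close> face
      at most one, and \<open>x\<close>, at position \<open>k - 1\<close>, faces none because
      \<open>1 div 2 = 0\<close>.\<close>
    define vs where "vs = y # ms @ [x]"
    have rest: "W - set vs = W' - M"
      by (auto simp: vs_def W'_def ms)
    show ?thesis
    proof (rule that[of vs])
      show "distinct vs" "set vs \<subseteq> W" "length vs = k"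
        using ms M(1) x(1) y(1,2) len k by (auto simp: vs_def W'_def)
      fix j assume j: "j < k"
      consider "j = 0" | "0 < j" "j < k - 1" | "j = k - 1"
        using j by linarith
      then show "j + card (neighbors G (vs ! j) \<inter> (W - set vs)) div 2 < k"
      proof cases
        case 1
        then show ?thesis
          using degI[OF y(1)] by (simp add: vs_def)
      next
        case 2
        then obtain i where i: "j = Suc i" "i < length ms"
          using len by (cases j) auto
        then have "vs ! j \<in> M"
          using ms(1) by (auto simp: vs_def nth_append)
        then have "card (neighbors G (vs ! j) \<inter> (W - set vs)) \<le> 2"
          using M(3) rest by simp
        then have "card (neighbors G (vs ! j) \<inter> (W - set vs)) div 2 \<le> 1"
          by linarith
        then show ?thesis
          using 2 by linarith
      next
        case 3
        then have "vs ! j = x"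
          using len k by (cases j) (auto simp: vs_def nth_append)
        moreover have "card (neighbors G x \<inter> (W - set vs)) \<le> card (neighbors G x \<inter> (W - {y}))"
          using finW by (intro card_mono) (auto simp: vs_def)
        ultimately have "card (neighbors G (vs ! j) \<inter> (W - set vs)) \<le> 1"
          using y(3) by simp
        then show ?thesis
          using j by simp
      qed
    qed
  qed
qed

section \<open>Extending a coloring over the block, and the induction\<close>

text \<open>The colors on \<open>vs\<close> are pairwise distinct, so a color class gains at most
  one vertex, and that vertex has at most one neighbor in the old class.\<close>

lemma (in graph) extend_arborable_coloring:
  assumes W: "W \<subseteq> verts G" and L: "\<And>v. v \<in> verts G \<Longrightarrow> finite (L v) \<and> card (L v) = k"
    and vs: "distinct vs" "set vs \<subseteq> W"
    "\<And>j. j < length vs \<Longrightarrow> j + card (neighbors G (vs ! j) \<inter> (W - set vs)) div 2 < k"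
    and c0: "\<forall>v \<in> W - set vs. c0 v \<in> L v" "\<forall>x. forest_on G {v \<in> W - set vs. c0 v = x}"
  obtains c where "\<forall>v \<in> W. c v \<in> L v" "\<forall>x. forest_on G {v \<in> W. c v = x}"
    "\<forall>x. card {v \<in> W. c v = x} \<le> Suc (card {v \<in> W - set vs. c0 v = x})"
proof -
  have finW: "finite W"
    using W finite_verts finite_subset by blast
  have "finite (L v) \<and> finite (neighbors G v \<inter> (W - set vs))" if "v \<in> set vs" for v
    using that vs(2) W L finW by auto
  moreover have "j + card (neighbors G (vs ! j) \<inter> (W - set vs)) div 2 < card (L (vs ! j))"
    if "j < length vs" for j
  proof -
    have "vs ! j \<in> verts G"
      using that vs(2) W nth_mem by blast
    then show ?thesis
      using vs(3)[OF that] L by simp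
  qed
  ultimately obtain c where c: "\<And>v. v \<notin> set vs \<Longrightarrow> c v = c0 v" "inj_on c (set vs)"
    "\<And>v. v \<in> set vs \<Longrightarrow> c v \<in> L v \<and> card {u \<in> neighbors G v \<inter> (W - set vs). c0 u = c v} \<le> 1"
    using extend_list_coloring[OF vs(1), of L "\<lambda>v. neighbors G v \<inter> (W - set vs)" c0] by blast
  have cls: "{v \<in> W. c v = x} = {v \<in> W - set vs. c0 v = x} \<or>
    (\<exists>w \<in> set vs. c w = x \<and> {v \<in> W. c v = x} = insert w {v \<in> W - set vs. c0 v = x})" for x
  proof (cases "\<exists>w \<in> set vs. c w = x")
    case True
    then obtain w where w: "w \<in> set vs" "c w = x" by blast
    then have "{v \<in> W. c v = x} = insert w {v \<in> W - set vs. c0 v = x}"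
      using c(1,2) vs(2) by (auto simp: inj_on_def)
    with w show ?thesis by blast
  next
    case False
    then have "{v \<in> W. c v = x} = {v \<in> W - set vs. c0 v = x}"
      using c(1) by auto
    then show ?thesis ..
  qed
  show ?thesis
  proof (rule that[of c])
    show "\<forall>v \<in> W. c v \<in> L v"
      using c(1,3) c0(1) by (metis DiffI)
    show "\<forall>x. forest_on G {v \<in> W. c v = x}"
    proof
      fix x
      from cls[of x] show "forest_on G {v \<in> W. c v = x}"
      proof (elim disjE bexE conjE)
        fix w assume w: "w \<in> set vs" "c w = x"
          and eq: "{v \<in> W. c v = x} = insert w {v \<in> W - set vs. c0 v = x}"
        have "neighbors G w \<inter> {v \<in> W - set vs. c0 v = x} =
            {u \<in> neighbors G w \<inter> (W - set vs). c0 u = c w}"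
          using w(2) by auto
        then show ?thesis
          unfolding eq using c0(2) c(3)[OF w(1)] by (intro forest_on_insert) auto
      qed (use c0(2) in simp)
    qed
    show "\<forall>x. card {v \<in> W. c v = x} \<le> Suc (card {v \<in> W - set vs. c0 v = x})"
    proof
      fix x
      from cls[of x] show "card {v \<in> W. c v = x} \<le> Suc (card {v \<in> W - set vs. c0 v = x})"
        using finW by (elim disjE bexE conjE) (simp_all add: card_insert_if)
    qed
  qed
qed

text \<open>The graph stays fixed and only \<open>W\<close> shrinks, so degeneracy and the degree
  bound carry over unchanged. Quantifying over \<open>m\<close> with
  \<open>card W \<le> m * k\<close> expresses the ceiling of \<open>card W / k\<close> without
  division.\<close>

lemma (in graph) degenerate_equitable_coloring:
  assumes "degenerate 2 G" "0 < k" "W \<subseteq> verts G"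
    and deg: "\<And>v. v \<in> verts G \<Longrightarrow> card (neighbors G v) < 2 * k"
    and L: "\<And>v. v \<in> verts G \<Longrightarrow> finite (L v) \<and> card (L v) = k"
  shows "\<exists>c. (\<forall>v \<in> W. c v \<in> L v) \<and> (\<forall>x. forest_on G {v \<in> W. c v = x}) \<and>
    (\<forall>x m. card W \<le> m * k \<longrightarrow> card {v \<in> W. c v = x} \<le> m)"
  using assms(3)
proof (induction "card W" arbitrary: W rule: less_induct)
  case less
  have finW: "finite W"
    using less.prems finite_verts finite_subset by blast
  have forest_empty: "forest_on G {}"
    by (auto simp: forest_on_def)
  show ?case
  proof (cases "card W < k")
    case True
    obtain vs where vs: "set vs = W" "distinct vs"
      using finW finite_distinct_list by blast
    then have "length vs < k"
      using True distinct_card by fastforce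
    \<comment> \<open>Here all of \<open>W\<close> is the block. The coloring of the empty rest is
      arbitrary, hence \<open>undefined\<close>, and all vertices of \<open>W\<close> get different
      colors.\<close>
    then obtain c where c: "\<forall>v \<in> W. c v \<in> L v" "\<forall>x. forest_on G {v \<in> W. c v = x}"
      "\<forall>x. card {v \<in> W. c v = x} \<le> 1"
      using extend_arborable_coloring[of W L k vs undefined] less.prems L vs forest_empty by auto
    have "card {v \<in> W. c v = x} \<le> m" if "card W \<le> m * k" for x m
    proof (cases m)
      case 0
      then have "W = {}"
        using that finW by simp
      then show ?thesis by simp
    next
      case (Suc i)
      then show ?thesis
        using spec[OF c(3), of x] by linarith
    qed
    with c show ?thesis by blast
  next
    case False
    then obtain vs where vs: "distinct vs" "set vs \<subseteq> W" "length vs = k"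
      "\<And>j. j < k \<Longrightarrow> j + card (neighbors G (vs ! j) \<inter> (W - set vs)) div 2 < k"
      using degenerate_removable_block[OF assms(1) less.prems assms(2) _ deg] by auto
    have card: "card (W - set vs) = card W - k"
      using vs by (simp add: card_Diff_subset distinct_card)
    then have "card (W - set vs) < card W"
      using False assms(2) by linarith
    then obtain c0 where c0: "\<forall>v \<in> W - set vs. c0 v \<in> L v"
      "\<forall>x. forest_on G {v \<in> W - set vs. c0 v = x}"
      "\<forall>x m. card (W - set vs) \<le> m * k \<longrightarrow> card {v \<in> W - set vs. c0 v = x} \<le> m"
      using less.hyps[OF _ subset_trans[OF Diff_subset less.prems]] by blast
    obtain c where c: "\<forall>v \<in> W. c v \<in> L v" "\<forall>x. forest_on G {v \<in> W. c v = x}"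
      "\<forall>x. card {v \<in> W. c v = x} \<le> Suc (card {v \<in> W - set vs. c0 v = x})"
      using extend_arborable_coloring[OF less.prems L vs(1,2) _ c0(1,2)] vs(3,4) by blast
    have "card {v \<in> W. c v = x} \<le> m" if W: "card W \<le> m * k" for x m
    proof -
      \<comment> \<open>Since \<open>W\<close> has at least \<open>k > 0\<close> vertices,
        \<open>m\<close> is positive. Removing \<open>k\<close> vertices lowers it by one, which
        pays for the one vertex that a class may gain.\<close>
      obtain i where i: "m = Suc i"
        using W False assms(2) by (cases m) auto
      then have "card (W - set vs) \<le> i * k"
        using W card by simp
      then show ?thesis
        using c0(3) c(3) i by (meson Suc_le_mono le_trans)
    qed
    with c show ?thesis by blast
  qed
qed

theorem theorem2:
  fixes G :: "('a, 'b) pre_digraph" and k :: nat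
  assumes "graph G"
    and "degenerate 2 G"
    and "int k \<ge> \<lceil>(real (max_degree G) + 1) / 2\<rceil>"
  shows "equitable_list_point_arborable TYPE('c) k G"
  unfolding equitable_list_point_arborable_def
proof (intro allI impI)
  interpret graph G by fact
  fix L :: "'a \<Rightarrow> 'c set" assume "list_assignment G k L"
  then have L: "\<And>v. v \<in> verts G \<Longrightarrow> finite (L v) \<and> card (L v) = k"
    by (simp add: list_assignment_def)
  \<comment> \<open>The hypothesis on \<open>k\<close> amounts to
    \<open>max_degree G + 1 \<le> 2 * k\<close>, which also makes \<open>k\<close> positive.\<close>
  have "(real (max_degree G) + 1) / 2 \<le> real k"
    using assms(3) by (simp add: ceiling_le_iff)
  then have "real (max_degree G + 1) \<le> real (2 * k)"
    by simp
  then have "max_degree G + 1 \<le> 2 * k"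
    by (simp only: of_nat_le_iff)
  then have md: "max_degree G < 2 * k" and k: "0 < k"
    by auto
  have "card (neighbors G v) < 2 * k" if "v \<in> verts G" for v
  proof -
    have "card (neighbors G v) \<le> degree G v"
      by (rule card_neighbors_le_degree) unfold_locales
    also have "\<dots> \<le> max_degree G"
      using that by (simp add: max_degree_def)
    finally show ?thesis using md by linarith
  qed
  then obtain c where c: "\<forall>v \<in> verts G. c v \<in> L v"
    "\<forall>x. forest_on G {v \<in> verts G. c v = x}"
    "\<forall>x m. card (verts G) \<le> m * k \<longrightarrow> card {v \<in> verts G. c v = x} \<le> m"
    using degenerate_equitable_coloring[OF assms(2) k order_refl _, of L] L by blast
  \<comment> \<open>The least \<open>m\<close> with \<open>card (verts G) \<le> m * k\<close>. The
    ceiling is nonnegative, so \<open>nat\<close> loses nothing.\<close>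
  define m where "m = nat \<lceil>real (card (verts G)) / real k\<rceil>"
  have "real (card (verts G)) / real k \<le> real m"
    unfolding m_def by linarith
  then have "real (card (verts G)) \<le> real (m * k)"
    using k by (simp add: divide_le_eq)
  then have "card (verts G) \<le> m * k"
    by (simp only: of_nat_le_iff)
  then have "card (color_class G c x) \<le> m" for x
    using c(3) by (simp add: color_class_def)
  moreover have "0 \<le> \<lceil>real (card (verts G)) / real k\<rceil>"
    using ceiling_mono[of 0 "real (card (verts G)) / real k"] by simp
  then have "int m = \<lceil>real (card (verts G)) / real k\<rceil>"
    unfolding m_def by (rule nat_0_le)
  ultimately have "int (card (color_class G c x)) \<le> \<lceil>real (card (verts G)) / real k\<rceil>" for x
    by (metis of_nat_le_iff)
  moreover have "acyclic_graph (G \<restriction> color_class G c x)" for x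
    using c(2) by (intro forest_on_imp_acyclic_graph) (auto simp: color_class_def)
  ultimately show "\<exists>c. (\<forall>v \<in> verts G. c v \<in> L v) \<and>
      (\<forall>x. acyclic_graph (G \<restriction> color_class G c x)) \<and>
      (\<forall>x. int (card (color_class G c x)) \<le> \<lceil>real (card (verts G)) / real k\<rceil>)"
    using c(1) by blast
qed

end
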